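(* Let $d_1,d_2,d_3$ be positive integers with $\gcd(d_1,d_2,d_3)=1$, and let $B=\mathrm{diag}(d_1,d_2,-d_3)$. Then the following are equivalent: (a) The $I(B)$-module $\mathcal C^{\rm pol}(B)$ is generated by $Q_1,Q_2,Q_3$, and the algebra $I(B)$ admits an algebraically independent generator system. (b) There exist relatively prime integers $\ell_1>1$ and $\ell_2>1$ such that $\ell_2$ divides $d_1$, $\ell_1$ divides $d_2$, and $d_3=\ell_1\ell_2$.
   Context: On $\mathbb C^3$ with standard basis $e_1,e_2,e_3$ let $Q_j(x)=x_je_j$. $[g,h](x)=Dh(x)g(x)-Dg(x)h(x)$, $X_g(\phi)(x)=D\phi(x)g(x)$; a matrix $B$ is identified with the vector field $x\mapsto Bx$. $$I(B)=\{\phi\in\mathbb C[x_1,x_2,x_3];\ X_B(\phi)=0\},\qquad\mathcal C^{\rm pol}(B)=\{g\in\mathbb C[x_1,x_2,x_3]^3;\ [B,g]=0\}.$$ *)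

theory Defs
  imports "HOL-Analysis.Analysis" "HOL-Library.Poly_Mapping"
begin

text \<open>
  Polynomials with complex coefficients in variables from \<open>'v\<close>: finitely supported maps from
  exponent vectors to coefficients, with the convolution product of \<open>Poly_Mapping\<close>.
  The type \<open>3\<close> has the elements \<open>1, 2, 3\<close> (with \<open>3 = 0\<close>), so \<open>3 mpol\<close> is
  the ring of complex polynomials in three variables, and \<open>3 mpol ^ 3\<close> is the
  type of polynomial vector fields on complex 3-space.
\<close>

type_synonym 'v mpol = "('v \<Rightarrow>\<^sub>0 nat) \<Rightarrow>\<^sub>0 complex"

definition Const :: "complex \<Rightarrow> 'v mpol"
  where "Const c = Poly_Mapping.single 0 c"

definition Var :: "'v \<Rightarrow> 'v mpol"
  where "Var i = Poly_Mapping.single (Poly_Mapping.single i 1) 1"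

text \<open>
  In \<open>pderiv_mpol\<close> the subtraction of exponents truncates only for monomials not containing
  the \<open>i\<close>-th variable, and those get the coefficient 0.
\<close>

definition pderiv_mpol :: "'v \<Rightarrow> 'v mpol \<Rightarrow> 'v mpol"
  where "pderiv_mpol i p =
    (\<Sum>m \<in> Poly_Mapping.keys p.
       Poly_Mapping.single (m - Poly_Mapping.single i 1)
         (of_nat (Poly_Mapping.lookup m i) * Poly_Mapping.lookup p m))"

definition subst_mpol :: "('v \<Rightarrow> 'w mpol) \<Rightarrow> 'v mpol \<Rightarrow> 'w mpol"
  where "subst_mpol f p =
    (\<Sum>m \<in> Poly_Mapping.keys p.
       Const (Poly_Mapping.lookup p m) *
         (\<Prod>v \<in> Poly_Mapping.keys m. f v ^ Poly_Mapping.lookup m v))"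

definition vars_mpol :: "'v mpol \<Rightarrow> 'v set"
  where "vars_mpol p = (\<Union>m \<in> Poly_Mapping.keys p. Poly_Mapping.keys m)"

definition lie_deriv :: "3 mpol ^ 3 \<Rightarrow> 3 mpol \<Rightarrow> 3 mpol"
  where "lie_deriv g \<phi> = (\<Sum>j\<in>UNIV. pderiv_mpol j \<phi> * g $ j)"

definition lie_bracket :: "3 mpol ^ 3 \<Rightarrow> 3 mpol ^ 3 \<Rightarrow> 3 mpol ^ 3"
  where "lie_bracket g h =
    (\<chi> i. (\<Sum>j\<in>UNIV. pderiv_mpol j (h $ i) * g $ j) - (\<Sum>j\<in>UNIV. pderiv_mpol j (g $ i) * h $ j))"

definition linear_field :: "complex ^ 3 ^ 3 \<Rightarrow> 3 mpol ^ 3"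
  where "linear_field B = (\<chi> i. \<Sum>j\<in>UNIV. Const (B $ i $ j) * Var j)"

definition invariants :: "complex ^ 3 ^ 3 \<Rightarrow> 3 mpol set"
  where "invariants B = {\<phi>. lie_deriv (linear_field B) \<phi> = 0}"

definition pol_centralizer :: "complex ^ 3 ^ 3 \<Rightarrow> (3 mpol ^ 3) set"
  where "pol_centralizer B = {g. lie_bracket (linear_field B) g = 0}"

definition Q :: "3 \<Rightarrow> 3 mpol ^ 3"
  where "Q j = (\<chi> i. if i = j then Var j else 0)"

definition diag :: "complex ^ 3 \<Rightarrow> complex ^ 3 ^ 3"
  where "diag v = (\<chi> i j. if i = j then v $ i else 0)"

definition module_span :: "3 mpol set \<Rightarrow> (3 mpol ^ 3) set \<Rightarrow> (3 mpol ^ 3) set"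
  where "module_span R G = {\<Sum>g\<in>F. r g *s g | F r. finite F \<and> F \<subseteq> G \<and> r ` F \<subseteq> R}"

inductive_set subalgebra_gen :: "'v mpol set \<Rightarrow> 'v mpol set" for S
  where
    gen_const: "Const c \<in> subalgebra_gen S"
  | gen_base: "p \<in> S \<Longrightarrow> p \<in> subalgebra_gen S"
  | gen_add: "p \<in> subalgebra_gen S \<Longrightarrow> q \<in> subalgebra_gen S \<Longrightarrow> p + q \<in> subalgebra_gen S"
  | gen_mult: "p \<in> subalgebra_gen S \<Longrightarrow> q \<in> subalgebra_gen S \<Longrightarrow> p * q \<in> subalgebra_gen S"

text \<open>
  Algebraic independence of a (possibly infinite) set \<open>S\<close>: the polynomial relations use the
  elements of \<open>S\<close> themselves as names of the variables, and each variable is substituted by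
  the element it names.
\<close>

definition alg_independent :: "'v mpol set \<Rightarrow> bool"
  where "alg_independent S \<longleftrightarrow>
    (\<forall>P :: 'v mpol mpol. vars_mpol P \<subseteq> S \<longrightarrow> subst_mpol (\<lambda>s. s) P = 0 \<longrightarrow> P = 0)"

end

theory Submission
  imports Defs "HOL-Computational_Algebra.Polynomial"
begin

text \<open>
  Both \<open>invariants B\<close> and \<open>pol_centralizer B\<close> are spanned by monomials, so the
  module condition says that \<open>d1 m1 + d2 m2 = d1 + d3 m3\<close> forces \<open>m1 > 0\<close> and
  symmetrically for \<open>d2\<close>, which means that \<open>l1 = gcd d2 d3\<close> and
  \<open>l2 = gcd d1 d3\<close> exceed 1. The invariants form the algebra of the monoid
  \<open>d1 m1 + d2 m2 = d3 m3\<close>, which has the atoms \<open>u = (d3/l2, 0, d1/l2)\<close> and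
  \<open>w = (0, d3/l1, d2/l1)\<close> and is generated by them iff \<open>d3 = l1 l2\<close>. If it is not, there
  is a third atom \<open>x\<close>, with \<open>d3 x = a u + b w\<close>. The coefficient of an invariant at an atom is
  a point derivation at the origin, so a free generating system would allow one to restrict the
  formal expressions of the three monomials to a line on which exactly a chosen subset of them
  vanishes to first order only. Comparing vanishing orders in the relation gives
  \<open>2 (a + b) \<le> d3\<close> when the subset is \<open>{x}\<close> and \<open>2 d3 \<le> a + b\<close> when it is
  \<open>{u, w}\<close>, a contradiction.
\<close>

section \<open>Evaluation of polynomials\<close>

lemma poly_mapping_sum_single:
  "(\<Sum>m\<in>Poly_Mapping.keys p. Poly_Mapping.single m (Poly_Mapping.lookup p m)) = p"
  by (rule poly_mapping_eqI) (simp add: lookup_sum lookup_single when_def in_keys_iff)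

text \<open>Additive statements need checking on monomials only. The zero polynomial is a monomial
  with coefficient 0, so no separate base case occurs.\<close>

lemma poly_mapping_single_add_induct [case_names single add]:
  fixes p :: "'a \<Rightarrow>\<^sub>0 'b::comm_monoid_add"
  assumes single: "\<And>m c. P (Poly_Mapping.single m c)"
    and add: "\<And>p q. P p \<Longrightarrow> P q \<Longrightarrow> P (p + q)"
  shows "P p"
proof -
  have "P (\<Sum>m\<in>K. Poly_Mapping.single m (f m))" if "finite K" for K f
    using that
  proof induction
    case empty
    then show ?case using single[of undefined 0] by simp
  qed (simp add: single add)
  from this[of "Poly_Mapping.keys p" "Poly_Mapping.lookup p"] show ?thesis
    by (simp add: poly_mapping_sum_single)
qed

definition eval_monom :: "('v \<Rightarrow> 'r::comm_ring_1) \<Rightarrow> ('v \<Rightarrow>\<^sub>0 nat) \<Rightarrow> 'r"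
  where "eval_monom f m = (\<Prod>v\<in>Poly_Mapping.keys m. f v ^ Poly_Mapping.lookup m v)"

lemma eval_monom_superset:
  assumes "finite K" "Poly_Mapping.keys m \<subseteq> K"
  shows "eval_monom f m = (\<Prod>v\<in>K. f v ^ Poly_Mapping.lookup m v)"
  unfolding eval_monom_def
  by (rule prod.mono_neutral_left) (use assms in \<open>auto simp: in_keys_iff\<close>)

lemma eval_monom_0 [simp]: "eval_monom f 0 = 1"
  by (simp add: eval_monom_def)

lemma eval_monom_single [simp]: "eval_monom f (Poly_Mapping.single v n) = f v ^ n"
  by (simp add: eval_monom_def)

lemma eval_monom_add: "eval_monom f (m + n) = eval_monom f m * eval_monom f n"
proof -
  let ?K = "Poly_Mapping.keys m \<union> Poly_Mapping.keys n"
  have "Poly_Mapping.keys (m + n) \<subseteq> ?K"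
    by (rule keys_add)
  then have "eval_monom f (m + n) = (\<Prod>v\<in>?K. f v ^ Poly_Mapping.lookup (m + n) v)"
    by (intro eval_monom_superset) auto
  also have "\<dots> = (\<Prod>v\<in>?K. f v ^ Poly_Mapping.lookup m v) * (\<Prod>v\<in>?K. f v ^ Poly_Mapping.lookup n v)"
    by (simp add: lookup_add power_add prod.distrib)
  also have "\<dots> = eval_monom f m * eval_monom f n"
    by (subst (1 2) eval_monom_superset[where K = ?K]) auto
  finally show ?thesis .
qed

locale coeff_hom =
  fixes h :: "complex \<Rightarrow> 'r::comm_ring_1"
  assumes hom_zero: "h 0 = 0" and hom_one: "h 1 = 1"
    and hom_add: "h (x + y) = h x + h y" and hom_mult: "h (x * y) = h x * h y"
begin

definition eval :: "('v \<Rightarrow> 'r) \<Rightarrow> 'v mpol \<Rightarrow> 'r"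
  where "eval f p = (\<Sum>m\<in>Poly_Mapping.keys p. h (Poly_Mapping.lookup p m) * eval_monom f m)"

lemma eval_superset:
  assumes "finite K" "Poly_Mapping.keys p \<subseteq> K"
  shows "eval f p = (\<Sum>m\<in>K. h (Poly_Mapping.lookup p m) * eval_monom f m)"
  unfolding eval_def
  by (rule sum.mono_neutral_left) (use assms in \<open>auto simp: in_keys_iff hom_zero\<close>)

lemma eval_single: "eval f (Poly_Mapping.single m c) = h c * eval_monom f m"
  by (simp add: eval_superset[where K = "{m}"])

lemma eval_add: "eval f (p + q) = eval f p + eval f q"
proof -
  let ?K = "Poly_Mapping.keys p \<union> Poly_Mapping.keys q"
  have "Poly_Mapping.keys (p + q) \<subseteq> ?K"
    by (rule keys_add)
  then have "eval f (p + q) = (\<Sum>m\<in>?K. h (Poly_Mapping.lookup (p + q) m) * eval_monom f m)"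
    by (intro eval_superset) auto
  also have "\<dots> = (\<Sum>m\<in>?K. h (Poly_Mapping.lookup p m) * eval_monom f m)
      + (\<Sum>m\<in>?K. h (Poly_Mapping.lookup q m) * eval_monom f m)"
    by (simp add: lookup_add hom_add distrib_right sum.distrib)
  also have "\<dots> = eval f p + eval f q"
    by (subst (1 2) eval_superset[where K = ?K]) auto
  finally show ?thesis .
qed

text \<open>Both sides are biadditive, so induction on each factor reduces the claim to two
  monomials, where exponents add.\<close>

lemma eval_mult: "eval f (p * q) = eval f p * eval f q"
proof (induction p rule: poly_mapping_single_add_induct)
  case (single m c)
  show ?case
    by (induction q rule: poly_mapping_single_add_induct)
      (simp_all add: mult_single eval_single eval_monom_add hom_mult eval_add distrib_left)
qed (simp add: distrib_right eval_add)

lemma eval_one: "eval f 1 = 1"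
  using eval_single[of f 0 1] by (simp add: hom_one)

lemma eval_power: "eval f (p ^ n) = eval f p ^ n"
  by (induction n) (simp_all add: eval_one eval_mult)

lemma eval_uminus: "eval f (- p) = - eval f p"
proof -
  have "eval f (- p) + eval f p = eval f (0 :: 'a mpol)"
    by (simp flip: eval_add)
  then show ?thesis
    by (simp add: eval_def eq_neg_iff_add_eq_0)
qed

lemma eval_diff: "eval f (p - q) = eval f p - eval f q"
  using eval_add[of f p "- q"] by (simp add: eval_uminus)

end

lemma Const_0 [simp]: "Const 0 = 0" and Const_1 [simp]: "Const 1 = 1"
  by (simp_all add: Const_def)

lemma Const_add: "Const (a + b) = Const a + Const b"
  by (simp add: Const_def single_add)

lemma Const_mult: "Const (a * b) = Const a * Const b"
  by (simp add: Const_def mult_single)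

interpretation subst: coeff_hom "Const :: complex \<Rightarrow> 'w mpol"
  rewrites "coeff_hom.eval Const = subst_mpol"
proof -
  show *: "coeff_hom (Const :: complex \<Rightarrow> 'w mpol)"
    by unfold_locales (simp_all add: Const_add Const_mult)
  show "coeff_hom.eval (Const :: complex \<Rightarrow> 'w mpol) = subst_mpol"
    by (intro ext) (simp add: coeff_hom.eval_def[OF *] subst_mpol_def eval_monom_def)
qed

interpretation upoly: coeff_hom "\<lambda>c. [:c:]"
  by unfold_locales simp_all

lemma lookup_Const_mult [simp]:
  "Poly_Mapping.lookup (Const c * p) m = c * Poly_Mapping.lookup p m"
  by (induction p rule: poly_mapping_single_add_induct)
    (simp_all add: Const_def mult_single lookup_single when_def distrib_left lookup_add)

lemma lookup_Const: "Poly_Mapping.lookup (Const c) m = (if m = 0 then c else 0)"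
  by (auto simp: Const_def lookup_single when_def)

lemma Const_mult_single: "Const c * Poly_Mapping.single m b = Poly_Mapping.single m (c * b)"
  by (simp add: Const_def mult_single)

section \<open>Generated subalgebras\<close>

lemma vars_mpol_add: "vars_mpol (p + q) \<subseteq> vars_mpol p \<union> vars_mpol q"
  unfolding vars_mpol_def using keys_add[of p q] by blast

lemma vars_mpol_mult: "vars_mpol (p * q) \<subseteq> vars_mpol p \<union> vars_mpol q"
proof
  fix x assume "x \<in> vars_mpol (p * q)"
  then obtain m where m: "m \<in> Poly_Mapping.keys (p * q)" "x \<in> Poly_Mapping.keys m"
    by (auto simp: vars_mpol_def)
  obtain a b where "a \<in> Poly_Mapping.keys p" "b \<in> Poly_Mapping.keys q" "m = a + b"
    using m(1) keys_mult[of p q] by auto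
  then show "x \<in> vars_mpol p \<union> vars_mpol q"
    using m(2) keys_add[of a b] by (auto simp: vars_mpol_def)
qed

lemma vars_mpol_power: "vars_mpol (p ^ n) \<subseteq> vars_mpol p"
proof (induction n)
  case 0
  show ?case by (simp add: vars_mpol_def)
next
  case (Suc n)
  then show ?case using vars_mpol_mult[of p "p ^ n"] by auto
qed

lemma vars_mpol_uminus: "vars_mpol (- p) = vars_mpol p"
  by (simp add: vars_mpol_def in_keys_iff)

lemma vars_mpol_diff: "vars_mpol (p - q) \<subseteq> vars_mpol p \<union> vars_mpol q"
  using vars_mpol_add[of p "- q"] by (simp add: vars_mpol_uminus)

lemma subst_mpol_Const [simp]: "subst_mpol f (Const c) = Const c"
  using subst.eval_single[of f 0 c] by (simp add: Const_def)

lemma subst_mpol_Var [simp]: "subst_mpol f (Var v) = f v"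
  unfolding Var_def by (simp add: subst.eval_single)

text \<open>The generators name the variables of \<open>P\<close>, exactly as in
  \<open>alg_independent\<close>. Relations between elements of the subalgebra can thus be lifted to
  their formal expressions.\<close>

lemma subalgebra_gen_subst:
  assumes "p \<in> subalgebra_gen S"
  obtains P where "vars_mpol P \<subseteq> S" "subst_mpol (\<lambda>s. s) P = p"
proof -
  from assms have "\<exists>P. vars_mpol P \<subseteq> S \<and> subst_mpol (\<lambda>s. s) P = p"
  proof induction
    case (gen_const c)
    show ?case
      by (rule exI[of _ "Const c"]) (simp add: vars_mpol_def, simp add: Const_def)
  next
    case (gen_base p)
    then show ?case
      by (intro exI[of _ "Var p"]) (simp, simp add: vars_mpol_def Var_def)
  next
    case (gen_add p q)
    then obtain P R where "vars_mpol P \<subseteq> S" "subst_mpol (\<lambda>s. s) P = p"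
      "vars_mpol R \<subseteq> S" "subst_mpol (\<lambda>s. s) R = q" by blast
    then show ?case
      using vars_mpol_add[of P R] by (intro exI[of _ "P + R"]) (auto simp: subst.eval_add)
  next
    case (gen_mult p q)
    then obtain P R where "vars_mpol P \<subseteq> S" "subst_mpol (\<lambda>s. s) P = p"
      "vars_mpol R \<subseteq> S" "subst_mpol (\<lambda>s. s) R = q" by blast
    then show ?case
      using vars_mpol_mult[of P R] by (intro exI[of _ "P * R"]) (auto simp: subst.eval_mult)
  qed
  then show thesis using that by blast
qed

lemma subalgebra_gen_sum:
  assumes "\<And>i. i \<in> I \<Longrightarrow> f i \<in> subalgebra_gen S"
  shows "sum f I \<in> subalgebra_gen S"
  using assms
proof (induction I rule: infinite_finite_induct)
  case (insert i I)
  then show ?case by (simp add: subalgebra_gen.gen_add)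
qed (use subalgebra_gen.gen_const[of 0] in auto)

lemma subalgebra_gen_power:
  assumes "p \<in> subalgebra_gen S"
  shows "p ^ n \<in> subalgebra_gen S"
proof (induction n)
  case 0
  show ?case using subalgebra_gen.gen_const[of 1] by simp
qed (simp add: assms subalgebra_gen.gen_mult)

section \<open>Diagonal linear vector fields\<close>

text \<open>This is the eigenvalue of the monomial with exponent \<open>m\<close> under the
  derivation given by \<open>diag v\<close>.\<close>

definition weight :: "complex ^ 3 \<Rightarrow> (3 \<Rightarrow>\<^sub>0 nat) \<Rightarrow> complex"
  where "weight v m = (\<Sum>j\<in>UNIV. v $ j * of_nat (Poly_Mapping.lookup m j))"

lemma weight_0 [simp]: "weight v 0 = 0"
  by (simp add: weight_def)

lemma weight_add: "weight v (m + n) = weight v m + weight v n"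
  by (simp add: weight_def lookup_add distrib_left sum.distrib)

lemma weight_single: "weight v (Poly_Mapping.single i n) = v $ i * of_nat n"
proof -
  have "weight v (Poly_Mapping.single i n) = (\<Sum>j\<in>UNIV. if j = i then v $ i * of_nat n else 0)"
    unfolding weight_def by (rule sum.cong) (auto simp: lookup_single when_def)
  then show ?thesis by simp
qed

lemma poly_mapping_minus_single_add:
  assumes "Poly_Mapping.lookup m i \<noteq> (0::nat)"
  shows "m - Poly_Mapping.single i 1 + Poly_Mapping.single i 1 = m"
  by (rule poly_mapping_eqI) (use assms in \<open>auto simp: lookup_add lookup_minus lookup_single when_def\<close>)

lemma pderiv_mpol_single:
  "pderiv_mpol j (Poly_Mapping.single m c) =
    Poly_Mapping.single (m - Poly_Mapping.single j 1) (of_nat (Poly_Mapping.lookup m j) * c)"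
  by (cases "c = 0") (simp_all add: pderiv_mpol_def)

text \<open>The Euler operator of one variable is diagonal on monomials: multiplying by
  \<open>Var j\<close> restores the exponent lowered by differentiation, and where the subtraction
  truncates, the coefficient is 0.\<close>

lemma lookup_pderiv_mpol_mult_Var:
  "Poly_Mapping.lookup (pderiv_mpol j p * Var j) m = of_nat (Poly_Mapping.lookup m j) * Poly_Mapping.lookup p m"
proof -
  have "Poly_Mapping.single (n - Poly_Mapping.single j 1) (of_nat (Poly_Mapping.lookup n j) * c) * Var j
      = Poly_Mapping.single n (of_nat (Poly_Mapping.lookup n j) * c)" for n and c :: complex
    by (cases "Poly_Mapping.lookup n j = 0")
      (use poly_mapping_minus_single_add[of n j] in \<open>simp_all add: Var_def mult_single\<close>)
  then have "pderiv_mpol j p * Var j = (\<Sum>n\<in>Poly_Mapping.keys p.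
      Poly_Mapping.single n (of_nat (Poly_Mapping.lookup n j) * Poly_Mapping.lookup p n))"
    by (simp add: pderiv_mpol_def sum_distrib_right)
  then show ?thesis
    by (simp add: lookup_sum lookup_single when_def in_keys_iff)
qed

lemma linear_field_diag: "linear_field (diag v) $ i = Const (v $ i) * Var i"
proof -
  have "linear_field (diag v) $ i = (\<Sum>j\<in>UNIV. if j = i then Const (v $ i) * Var i else 0)"
    unfolding linear_field_def vec_lambda_beta
    by (rule sum.cong) (auto simp: diag_def)
  then show ?thesis by simp
qed

lemma lookup_lie_deriv_diag:
  "Poly_Mapping.lookup (lie_deriv (linear_field (diag v)) p) m = weight v m * Poly_Mapping.lookup p m"
proof -
  have *: "pderiv_mpol j p * linear_field (diag v) $ j = Const (v $ j) * (pderiv_mpol j p * Var j)" for j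
    by (simp add: linear_field_diag mult.left_commute)
  show ?thesis
    unfolding lie_deriv_def * lookup_sum lookup_Const_mult lookup_pderiv_mpol_mult_Var weight_def
    by (simp add: sum_distrib_right mult.assoc)
qed

lemma invariants_diag:
  "p \<in> invariants (diag v) \<longleftrightarrow> (\<forall>m\<in>Poly_Mapping.keys p. weight v m = 0)"
  by (auto simp: invariants_def poly_mapping_eq_iff fun_eq_iff lookup_lie_deriv_diag in_keys_iff)

text \<open>For \<open>B = diag v\<close> the bracket has the components
  \<open>X_B(g_i) - v_i g_i\<close>, so each \<open>g_i\<close> must lie in the eigenspace of
  \<open>v_i\<close> of an operator that is diagonal on monomials.\<close>

lemma pol_centralizer_diag:
  "g \<in> pol_centralizer (diag v) \<longleftrightarrow> (\<forall>i. \<forall>m\<in>Poly_Mapping.keys (g $ i). weight v m = v $ i)"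
proof -
  have "pderiv_mpol j (linear_field (diag v) $ i) = (if j = i then Const (v $ i) else 0)" for i j
    by (simp add: linear_field_diag Var_def Const_mult_single pderiv_mpol_single lookup_single when_def)
      (simp add: Const_def)
  then have "(\<Sum>j\<in>UNIV. pderiv_mpol j (linear_field (diag v) $ i) * g $ j) = Const (v $ i) * g $ i" for i
    by (simp add: if_distrib[where f = "\<lambda>x. x * _"] cong: if_cong)
  then have "lie_bracket (linear_field (diag v)) g $ i
      = lie_deriv (linear_field (diag v)) (g $ i) - Const (v $ i) * g $ i" for i
    by (simp add: lie_bracket_def lie_deriv_def)
  then have "Poly_Mapping.lookup (lie_bracket (linear_field (diag v)) g $ i) m
      = (weight v m - v $ i) * Poly_Mapping.lookup (g $ i) m" for i m
    by (simp add: lookup_minus lookup_lie_deriv_diag left_diff_distrib)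
  then have "g \<in> pol_centralizer (diag v) \<longleftrightarrow>
      (\<forall>i m. (weight v m - v $ i) * Poly_Mapping.lookup (g $ i) m = 0)"
    by (simp add: pol_centralizer_def vec_eq_iff poly_mapping_eq_iff fun_eq_iff)
  also have "\<dots> \<longleftrightarrow> (\<forall>i. \<forall>m\<in>Poly_Mapping.keys (g $ i). weight v m = v $ i)"
    by (auto simp: in_keys_iff)
  finally show ?thesis .
qed

section \<open>The module generated by the fields Q_j\<close>

lemma Var_neq_0 [simp]: "Var i \<noteq> 0"
proof -
  have "Poly_Mapping.lookup (Var i) (Poly_Mapping.single i 1) \<noteq> 0"
    by (simp add: Var_def)
  then show ?thesis by (metis lookup_zero)
qed

lemma inj_Q: "inj Q"
proof (rule injI)
  fix i j assume "Q i = Q j"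
  then have "Q i $ i = Q j $ i" by simp
  then show "i = j" by (auto simp: Q_def split: if_splits)
qed

text \<open>The generators sit in different components, so their coefficients can be chosen
  separately. The coefficient 0 serves components whose generator is missing from the finite set
  \<open>F\<close>.\<close>

lemma module_span_Q:
  assumes "0 \<in> R"
  shows "g \<in> module_span R {Q 1, Q 2, Q 3} \<longleftrightarrow> (\<forall>i. \<exists>r\<in>R. g $ i = r * Var i)"
proof -
  have Q3: "{Q 1, Q 2, Q 3} = range Q"
    using UNIV_3 by (metis image_empty image_insert)
  show ?thesis unfolding Q3
  proof
    assume "g \<in> module_span R (range Q)"
    then obtain F r where F: "finite F" "F \<subseteq> range Q" "r ` F \<subseteq> R" "g = (\<Sum>h\<in>F. r h *s h)"
      by (auto simp: module_span_def)
    show "\<forall>i. \<exists>r\<in>R. g $ i = r * Var i"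
    proof
      fix i
      have "g $ i = (\<Sum>h\<in>F. r h * h $ i)"
        by (simp add: F)
      also have "\<dots> = (\<Sum>h\<in>F. if h = Q i then r h * Var i else 0)"
      proof (rule sum.cong)
        fix h assume "h \<in> F"
        then obtain j where j: "h = Q j" using F by blast
        have "Q j = Q i \<longleftrightarrow> j = i" using inj_Q by (auto dest: injD)
        then show "r h * h $ i = (if h = Q i then r h * Var i else 0)"
          by (simp add: j) (simp add: Q_def)
      qed simp
      also have "\<dots> = (if Q i \<in> F then r (Q i) else 0) * Var i"
        using F by simp
      finally show "\<exists>r\<in>R. g $ i = r * Var i"
        by (rule bexI) (use F assms in auto)
    qed
  next
    assume "\<forall>i. \<exists>r\<in>R. g $ i = r * Var i"
    then obtain r where r: "\<And>i. r i \<in> R" "\<And>i. g $ i = r i * Var i"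
      by metis
    have "g = (\<Sum>j\<in>UNIV. r j *s Q j)"
    proof (unfold vec_eq_iff, rule allI)
      fix i
      have "(\<Sum>j\<in>UNIV. r j *s Q j) $ i = (\<Sum>j\<in>UNIV. if j = i then r j * Var j else 0)"
        unfolding sum_component by (rule sum.cong) (auto simp: Q_def)
      then show "g $ i = (\<Sum>j\<in>UNIV. r j *s Q j) $ i"
        by (simp add: r)
    qed
    \<comment> \<open>The span wants coefficients indexed by the generators themselves;
      \<open>inv Q\<close> reindexes them, as \<open>Q\<close> is injective.\<close>
    then have "g = (\<Sum>h\<in>range Q. r (inv Q h) *s h)"
      by (simp add: sum.reindex[OF inj_Q] inv_f_f[OF inj_Q])
    then show "g \<in> module_span R (range Q)"
      unfolding module_span_def using r(1)
      by (intro CollectI exI[of _ "range Q"] exI[of _ "\<lambda>h. r (inv Q h)"]) auto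
  qed
qed

text \<open>Division by \<open>Var i\<close> shifts exponents. The bound on the keys of the quotient
  allows its weights to be read off later.\<close>

lemma mpol_eq_mult_Var:
  assumes "\<And>m. m \<in> Poly_Mapping.keys p \<Longrightarrow> Poly_Mapping.lookup m i \<noteq> 0"
  obtains r where "p = r * Var i"
    "Poly_Mapping.keys r \<subseteq> (\<lambda>m. m - Poly_Mapping.single i 1) ` Poly_Mapping.keys p"
proof
  define r where "r = (\<Sum>m\<in>Poly_Mapping.keys p.
    Poly_Mapping.single (m - Poly_Mapping.single i 1) (Poly_Mapping.lookup p m))"
  have "r * Var i = (\<Sum>m\<in>Poly_Mapping.keys p. Poly_Mapping.single m (Poly_Mapping.lookup p m))"
    unfolding r_def sum_distrib_right
    by (rule sum.cong) (simp_all add: Var_def mult_single poly_mapping_minus_single_add[OF assms, simplified])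
  then show "p = r * Var i"
    by (simp add: poly_mapping_sum_single)
  show "Poly_Mapping.keys r \<subseteq> (\<lambda>m. m - Poly_Mapping.single i 1) ` Poly_Mapping.keys p"
    unfolding r_def by (rule order_trans[OF keys_sum]) auto
qed

lemma lookup_mult_Var_eq_0:
  assumes "Poly_Mapping.lookup m i = 0"
  shows "Poly_Mapping.lookup (p * Var i) m = 0"
proof (rule ccontr)
  assume "Poly_Mapping.lookup (p * Var i) m \<noteq> 0"
  then have "m \<in> Poly_Mapping.keys (p * Var i)"
    by (simp add: in_keys_iff)
  then obtain a where "m = a + Poly_Mapping.single i 1"
    using keys_mult[of p "Var i"] by (auto simp: Var_def)
  then show False using assms by (simp add: lookup_add)
qed

text \<open>In component \<open>i\<close> the centralizer is spanned by the monomials of weight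
  \<open>v $ i\<close>, and the module by those among them that are divisible by
  \<open>Var i\<close>: the quotient has weight 0, hence is automatically invariant.\<close>

lemma pol_centralizer_diag_eq_span_iff:
  "pol_centralizer (diag v) = module_span (invariants (diag v)) {Q 1, Q 2, Q 3} \<longleftrightarrow>
    (\<forall>i m. weight v m = v $ i \<longrightarrow> Poly_Mapping.lookup m i \<noteq> 0)"
proof -
  have 0: "0 \<in> invariants (diag v)"
    by (simp add: invariants_diag)
  have span_le: "module_span (invariants (diag v)) {Q 1, Q 2, Q 3} \<subseteq> pol_centralizer (diag v)"
  proof
    fix g assume "g \<in> module_span (invariants (diag v)) {Q 1, Q 2, Q 3}"
    then have g: "\<exists>r\<in>invariants (diag v). g $ i = r * Var i" for i
      using module_span_Q[OF 0] by blast
    show "g \<in> pol_centralizer (diag v)"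
      unfolding pol_centralizer_diag
    proof (intro allI ballI)
      fix i m assume m: "m \<in> Poly_Mapping.keys (g $ i)"
      obtain r where r: "r \<in> invariants (diag v)" "g $ i = r * Var i"
        using g by blast
      have "m \<in> Poly_Mapping.keys (r * Var i)"
        using m unfolding r(2) .
      then obtain a where "a \<in> Poly_Mapping.keys r" "m = a + Poly_Mapping.single i 1"
        using keys_mult[of r "Var i"] by (auto simp: Var_def)
      then show "weight v m = v $ i"
        using r by (simp add: invariants_diag weight_add weight_single)
    qed
  qed
  show ?thesis
  proof
    assume eq: "pol_centralizer (diag v) = module_span (invariants (diag v)) {Q 1, Q 2, Q 3}"
    show "\<forall>i m. weight v m = v $ i \<longrightarrow> Poly_Mapping.lookup m i \<noteq> 0"
    proof (intro allI impI)
      fix i m assume m: "weight v m = v $ i"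
      \<comment> \<open>A single monomial in component \<open>i\<close> tests the exponent
        \<open>m\<close>.\<close>
      define g :: "3 mpol ^ 3" where "g = (\<chi> j. if j = i then Poly_Mapping.single m 1 else 0)"
      have "g \<in> pol_centralizer (diag v)"
        using m by (auto simp: pol_centralizer_diag g_def)
      then have "\<exists>r\<in>invariants (diag v). g $ i = r * Var i"
        unfolding eq module_span_Q[OF 0] by (rule spec)
      then obtain r where "g $ i = r * Var i" ..
      moreover have "g $ i = Poly_Mapping.single m 1"
        by (simp add: g_def)
      ultimately have "Poly_Mapping.lookup (r * Var i) m = 1"
        by (metis lookup_single_eq)
      then show "Poly_Mapping.lookup m i \<noteq> 0"
        using lookup_mult_Var_eq_0[of m i r] by auto
    qed
  next
    assume *: "\<forall>i m. weight v m = v $ i \<longrightarrow> Poly_Mapping.lookup m i \<noteq> 0"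
    have "g \<in> module_span (invariants (diag v)) {Q 1, Q 2, Q 3}" if g: "g \<in> pol_centralizer (diag v)" for g
      unfolding module_span_Q[OF 0]
    proof
      fix i
      have nz: "Poly_Mapping.lookup m i \<noteq> 0" if "m \<in> Poly_Mapping.keys (g $ i)" for m
        using g that by (intro *[rule_format]) (simp add: pol_centralizer_diag)
      obtain r where r: "g $ i = r * Var i"
        "Poly_Mapping.keys r \<subseteq> (\<lambda>m. m - Poly_Mapping.single i 1) ` Poly_Mapping.keys (g $ i)"
        by (rule mpol_eq_mult_Var[of "g $ i" i, OF nz])
      have "weight v n = 0" if n: "n \<in> Poly_Mapping.keys r" for n
      proof -
        obtain m where m: "m \<in> Poly_Mapping.keys (g $ i)" "n = m - Poly_Mapping.single i 1"
          using n r(2) by blast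
        have "weight v m = v $ i"
          using g m(1) by (simp add: pol_centralizer_diag)
        then have "weight v (n + Poly_Mapping.single i 1) = v $ i"
          unfolding m(2) poly_mapping_minus_single_add[OF nz[OF m(1)]] .
        then show ?thesis by (simp add: weight_add weight_single)
      qed
      then have "r \<in> invariants (diag v)"
        by (simp add: invariants_diag)
      with r(1) show "\<exists>r\<in>invariants (diag v). g $ i = r * Var i" ..
    qed
    then show "pol_centralizer (diag v) = module_span (invariants (diag v)) {Q 1, Q 2, Q 3}"
      using span_le by blast
  qed
qed

section \<open>Algebras of invariants and their atoms\<close>

lemma invariants_diag_Const [simp]: "Const c \<in> invariants (diag v)"
  by (auto simp: invariants_diag Const_def)

lemma invariants_diag_add:
  assumes "p \<in> invariants (diag v)" "q \<in> invariants (diag v)"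
  shows "p + q \<in> invariants (diag v)"
  using assms keys_add[of p q] unfolding invariants_diag by blast

lemma invariants_diag_mult:
  assumes "p \<in> invariants (diag v)" "q \<in> invariants (diag v)"
  shows "p * q \<in> invariants (diag v)"
  unfolding invariants_diag
proof
  fix m assume "m \<in> Poly_Mapping.keys (p * q)"
  then obtain a b where "a \<in> Poly_Mapping.keys p" "b \<in> Poly_Mapping.keys q" "m = a + b"
    using keys_mult[of p q] by auto
  then show "weight v m = 0"
    using assms by (simp add: invariants_diag weight_add)
qed

section \<open>Atoms of the weight-zero monoid and coefficients of products\<close>

lemma exponent_add_eq_0_iff: "a + b = 0 \<longleftrightarrow> a = 0 \<and> b = 0"
  for a b :: "'v \<Rightarrow>\<^sub>0 nat"
  by (auto simp: poly_mapping_eq_iff fun_eq_iff lookup_add)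

text \<open>These are the irreducible elements of the monoid of exponents of weight 0. Only
  splittings within this monoid count.\<close>

definition atom :: "complex ^ 3 \<Rightarrow> (3 \<Rightarrow>\<^sub>0 nat) \<Rightarrow> bool"
  where "atom v u \<longleftrightarrow> weight v u = 0 \<and> u \<noteq> 0 \<and>
    (\<forall>a b. weight v a = 0 \<longrightarrow> weight v b = 0 \<longrightarrow> a + b = u \<longrightarrow> a = 0 \<or> b = 0)"

text \<open>Only products with a constant term can reach \<open>m\<close>. At \<open>m = 0\<close>
  the first two summands both count the product of the constant terms, hence the correction.\<close>

lemma lookup_mult_split:
  fixes p q :: "'v mpol"
  assumes "\<And>a b. a \<in> Poly_Mapping.keys p \<Longrightarrow> b \<in> Poly_Mapping.keys q \<Longrightarrow> a \<noteq> 0 \<Longrightarrow> b \<noteq> 0 \<Longrightarrow> a + b \<noteq> m"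
  shows "Poly_Mapping.lookup (p * q) m =
    Poly_Mapping.lookup p 0 * Poly_Mapping.lookup q m + Poly_Mapping.lookup q 0 * Poly_Mapping.lookup p m
    - (if m = 0 then Poly_Mapping.lookup p 0 * Poly_Mapping.lookup q 0 else 0)"
proof -
  let ?c = "Poly_Mapping.lookup p 0" and ?d = "Poly_Mapping.lookup q 0"
  have "m \<notin> Poly_Mapping.keys ((p - Const ?c) * (q - Const ?d))"
  proof
    assume "m \<in> Poly_Mapping.keys ((p - Const ?c) * (q - Const ?d))"
    then obtain a b where ab: "a \<in> Poly_Mapping.keys (p - Const ?c)" "b \<in> Poly_Mapping.keys (q - Const ?d)" "m = a + b"
      using keys_mult[of "p - Const ?c" "q - Const ?d"] by auto
    then have "a \<noteq> 0" "b \<noteq> 0"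
      by (auto simp: in_keys_iff lookup_minus lookup_Const)
    with ab show False
      using assms[of a b] by (simp add: in_keys_iff lookup_minus lookup_Const)
  qed
  moreover have "p * q = (p - Const ?c) * (q - Const ?d) + Const ?c * q + Const ?d * p - Const ?c * Const ?d"
    by (simp add: algebra_simps)
  then have "Poly_Mapping.lookup (p * q) m = Poly_Mapping.lookup ((p - Const ?c) * (q - Const ?d)) m
      + ?c * Poly_Mapping.lookup q m + ?d * Poly_Mapping.lookup p m - ?c * Poly_Mapping.lookup (Const ?d) m"
    by (metis lookup_add lookup_minus lookup_Const_mult)
  ultimately show ?thesis
    by (simp add: lookup_Const in_keys_iff)
qed

lemma lookup_mult_0:
  "Poly_Mapping.lookup (p * q) 0 = Poly_Mapping.lookup p 0 * Poly_Mapping.lookup q 0"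
  for p q :: "'v mpol"
  by (subst lookup_mult_split) (auto simp: exponent_add_eq_0_iff)

lemma lookup_mult_atom:
  assumes "p \<in> invariants (diag v)" "q \<in> invariants (diag v)" "atom v u"
  shows "Poly_Mapping.lookup (p * q) u =
    Poly_Mapping.lookup p 0 * Poly_Mapping.lookup q u + Poly_Mapping.lookup q 0 * Poly_Mapping.lookup p u"
proof -
  have "u \<noteq> 0" using assms by (simp add: atom_def)
  moreover have "a + b \<noteq> u" if "a \<in> Poly_Mapping.keys p" "b \<in> Poly_Mapping.keys q" "a \<noteq> 0" "b \<noteq> 0" for a b
    using assms that unfolding atom_def invariants_diag by blast
  ultimately show ?thesis
    by (subst lookup_mult_split) auto
qed

text \<open>By \<open>lookup_mult_atom\<close>, summing the coefficients at some atoms is a point derivation of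
  the invariants at the origin, so sending each generator to its first-order jet gives the jet of
  the whole polynomial.\<close>

definition agrees_to_first_order :: "complex ^ 3 \<Rightarrow> (3 \<Rightarrow>\<^sub>0 nat) set \<Rightarrow> complex poly \<Rightarrow> 3 mpol \<Rightarrow> bool"
  where "agrees_to_first_order v U e p \<longleftrightarrow> p \<in> invariants (diag v) \<and>
    coeff e 0 = Poly_Mapping.lookup p 0 \<and> coeff e 1 = (\<Sum>u\<in>U. Poly_Mapping.lookup p u)"

context
  fixes v :: "complex ^ 3" and U :: "(3 \<Rightarrow>\<^sub>0 nat) set"
  assumes atoms: "\<And>u. u \<in> U \<Longrightarrow> atom v u"
begin

lemma agrees_Const: "agrees_to_first_order v U [:c:] (Const c)"
proof -
  have "0 \<notin> U" using atoms by (auto simp: atom_def)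
  then have "(\<Sum>u\<in>U. Poly_Mapping.lookup (Const c) u) = 0"
    by (intro sum.neutral) (auto simp: lookup_Const)
  then show ?thesis
    by (simp add: agrees_to_first_order_def lookup_Const)
qed

lemma agrees_add:
  assumes "agrees_to_first_order v U e p" "agrees_to_first_order v U f q"
  shows "agrees_to_first_order v U (e + f) (p + q)"
  using assms by (simp add: agrees_to_first_order_def invariants_diag_add lookup_add sum.distrib)

text \<open>The Leibniz rule at the atoms has the same shape as the formula for the linear
  coefficient of a product of univariate polynomials.\<close>

lemma agrees_mult:
  assumes "agrees_to_first_order v U e p" "agrees_to_first_order v U f q"
  shows "agrees_to_first_order v U (e * f) (p * q)"
proof -
  have pq: "p \<in> invariants (diag v)" "q \<in> invariants (diag v)"
    using assms by (simp_all add: agrees_to_first_order_def)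
  have "(\<Sum>u\<in>U. Poly_Mapping.lookup (p * q) u) = (\<Sum>u\<in>U. Poly_Mapping.lookup p 0 * Poly_Mapping.lookup q u
      + Poly_Mapping.lookup q 0 * Poly_Mapping.lookup p u)"
    by (rule sum.cong) (simp_all add: lookup_mult_atom[OF pq atoms])
  also have "\<dots> = coeff (e * f) 1"
    using assms by (simp add: agrees_to_first_order_def coeff_mult sum.distrib sum_distrib_left mult.commute)
  finally show ?thesis
    using assms by (simp add: agrees_to_first_order_def invariants_diag_mult lookup_mult_0 coeff_mult)
qed

lemma agrees_prod:
  assumes "\<And>i. i \<in> J \<Longrightarrow> agrees_to_first_order v U (e i) (p i)"
  shows "agrees_to_first_order v U (\<Prod>i\<in>J. e i) (\<Prod>i\<in>J. p i)"
  using assms agrees_Const[of 1]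
  by (induction J rule: infinite_finite_induct) (simp_all add: agrees_mult one_pCons)

lemma agrees_sum:
  assumes "\<And>i. i \<in> J \<Longrightarrow> agrees_to_first_order v U (e i) (p i)"
  shows "agrees_to_first_order v U (\<Sum>i\<in>J. e i) (\<Sum>i\<in>J. p i)"
  using assms agrees_Const[of 0]
  by (induction J rule: infinite_finite_induct) (simp_all add: agrees_add)

lemma agrees_power:
  assumes "agrees_to_first_order v U e p"
  shows "agrees_to_first_order v U (e ^ n) (p ^ n)"
  using agrees_prod[of "{..<n}" "\<lambda>_. e" "\<lambda>_. p"] assms by simp

text \<open>Each generator is replaced by a polynomial of degree at most 1. The coefficients of
  order 2 and above depend on the chosen expression \<open>P\<close>, but the first two depend only
  on the invariant it represents.\<close>

lemma agrees_eval:
  assumes "vars_mpol P \<subseteq> invariants (diag v)"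
  shows "agrees_to_first_order v U
    (upoly.eval (\<lambda>s. [:Poly_Mapping.lookup s 0, \<Sum>u\<in>U. Poly_Mapping.lookup s u:]) P)
    (subst_mpol (\<lambda>s. s) P)"
  unfolding upoly.eval_def subst_mpol_def eval_monom_def
proof (intro agrees_sum agrees_mult agrees_Const agrees_prod agrees_power)
  fix m s assume "m \<in> Poly_Mapping.keys P" "s \<in> Poly_Mapping.keys m"
  then have "s \<in> invariants (diag v)"
    using assms by (auto simp: vars_mpol_def)
  then show "agrees_to_first_order v U [:Poly_Mapping.lookup s 0, \<Sum>u\<in>U. Poly_Mapping.lookup s u:] s"
    by (simp add: agrees_to_first_order_def)
qed

end

section \<open>Vanishing orders of univariate polynomials at 0\<close>

lemma monom_sq_dvd:
  assumes "coeff p 0 = 0" "coeff p 1 = (0::complex)"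
  shows "[:0, 1:] ^ 2 dvd p"
proof -
  obtain a q where p: "p = pCons a q" by (cases p)
  obtain b r where q: "q = pCons b r" by (cases q)
  have "p = [:0, 1:] ^ 2 * r"
    using assms by (simp add: p q power2_eq_square)
  then show ?thesis by simp
qed

lemma monom_mult_of_coeff_0:
  assumes "coeff p 0 = 0" "coeff p 1 \<noteq> (0::complex)"
  obtains r where "p = [:0, 1:] * r" "poly r 0 \<noteq> 0"
proof -
  obtain a r where p: "p = pCons a r" by (cases p)
  show thesis
    by (rule that[of r]) (use assms in \<open>simp_all add: p poly_0_coeff_0\<close>)
qed

lemma monom_power_dvd_imp_le:
  assumes "[:0, 1:] ^ k dvd [:0, 1:] ^ n * r" "poly r (0::complex) \<noteq> 0"
  shows "k \<le> n"
proof (rule ccontr)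
  assume "\<not> k \<le> n"
  then obtain j where "0 < j" "k = n + j"
    using less_imp_add_positive[of n k] by auto
  then have "[:0, 1:] ^ n * [:0, 1:] ^ j dvd [:0, 1:] ^ n * r"
    using assms(1) by (simp only: power_add)
  then have "[:0, 1:] ^ j dvd r"
    by (subst (asm) dvd_mult_cancel_left) simp
  then have "[:0, 1:] dvd r"
    using \<open>0 < j\<close> by (meson dvd_power dvd_trans)
  then show False
    using assms(2) poly_eq_0_iff_dvd[of r 0] by simp
qed

text \<open>Independence lifts the monomial relation to the formal expressions of the three atoms,
  so it survives every substitution for the generators. Two substitutions then give opposite
  inequalities between vanishing orders.\<close>

lemma atoms_contradict_free:
  assumes S: "alg_independent S" "invariants (diag v) = subalgebra_gen S"
    and atoms: "atom v u\<^sub>1" "atom v u\<^sub>2" "atom v w"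
    and distinct: "u\<^sub>1 \<noteq> u\<^sub>2" "w \<noteq> u\<^sub>1" "w \<noteq> u\<^sub>2"
    and eq: "Poly_Mapping.single w (1::complex) ^ n =
      Poly_Mapping.single u\<^sub>1 1 ^ a * Poly_Mapping.single u\<^sub>2 1 ^ b"
  shows "n = 0"
proof -
  have SI: "S \<subseteq> invariants (diag v)"
    unfolding S(2) by (blast intro: subalgebra_gen.gen_base)
  have "\<exists>P. vars_mpol P \<subseteq> S \<and> subst_mpol (\<lambda>s. s) P = Poly_Mapping.single m 1" if "atom v m" for m
  proof -
    have "Poly_Mapping.single m 1 \<in> subalgebra_gen S"
      unfolding S(2)[symmetric] using that by (simp add: invariants_diag atom_def)
    then show ?thesis
      by (rule subalgebra_gen_subst) blast
  qed
  then obtain P where P: "\<And>m. atom v m \<Longrightarrow> vars_mpol (P m) \<subseteq> S"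
      "\<And>m. atom v m \<Longrightarrow> subst_mpol (\<lambda>s. s) (P m) = Poly_Mapping.single m 1"
    by metis
  let ?R = "P w ^ n - P u\<^sub>1 ^ a * P u\<^sub>2 ^ b"
  have "vars_mpol ?R \<subseteq> S"
    using vars_mpol_diff[of "P w ^ n" "P u\<^sub>1 ^ a * P u\<^sub>2 ^ b"] vars_mpol_mult[of "P u\<^sub>1 ^ a" "P u\<^sub>2 ^ b"]
      vars_mpol_power[of "P w" n] vars_mpol_power[of "P u\<^sub>1" a] vars_mpol_power[of "P u\<^sub>2" b]
      P(1)[OF atoms(1)] P(1)[OF atoms(2)] P(1)[OF atoms(3)] by blast
  moreover have "subst_mpol (\<lambda>s. s) ?R = 0"
    using atoms eq by (simp add: subst.eval_diff subst.eval_mult subst.eval_power P(2))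
  ultimately have "?R = 0"
    using S(1) unfolding alg_independent_def by blast
  then have R: "P w ^ n = P u\<^sub>1 ^ a * P u\<^sub>2 ^ b" by simp
  \<comment> \<open>\<open>J U\<close> sends the expression of an atom in \<open>U\<close> to a
    polynomial of order exactly 1 at 0, and that of any other atom to one of order at least
    2.\<close>
  define J where "J = (\<lambda>U. upoly.eval (\<lambda>s :: 3 mpol. [:Poly_Mapping.lookup s 0, \<Sum>u\<in>U. Poly_Mapping.lookup s u:]))"
  have J_eq: "J U (P w) ^ n = J U (P u\<^sub>1) ^ a * J U (P u\<^sub>2) ^ b" for U
    using arg_cong[OF R, of "J U"] by (simp add: J_def upoly.eval_mult upoly.eval_power)
  have J: "coeff (J U (P m)) 0 = 0" "coeff (J U (P m)) 1 = (if m \<in> U then 1 else 0)"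
    if "finite U" "\<forall>u\<in>U. atom v u" "atom v m" for U m
  proof -
    have "vars_mpol (P m) \<subseteq> invariants (diag v)"
      using P(1)[OF that(3)] SI by blast
    from agrees_eval[OF bspec[OF that(2)] this] have
      "agrees_to_first_order v U (J U (P m)) (Poly_Mapping.single m 1)"
      using that(3) by (simp add: J_def P(2))
    then show "coeff (J U (P m)) 0 = 0" "coeff (J U (P m)) 1 = (if m \<in> U then 1 else 0)"
      using that by (simp_all add: agrees_to_first_order_def lookup_single when_def atom_def)
  qed
  \<comment> \<open>For \<open>U = {w}\<close> the left side of \<open>J_eq\<close> has order
    exactly \<open>n\<close>, the right side order at least \<open>2 * (a + b)\<close>.\<close>
  have "2 * (a + b) \<le> n"
  proof -
    have J': "coeff (J {w} (P m)) 0 = 0" "coeff (J {w} (P m)) 1 = (if m = w then 1 else 0)" if "atom v m" for m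
      using J[of "{w}" m] atoms that by auto
    obtain r where r: "J {w} (P w) = [:0, 1:] * r" "poly r 0 \<noteq> 0"
      using monom_mult_of_coeff_0[of "J {w} (P w)"] J'[OF atoms(3)] by auto
    have "[:0, 1:] ^ 2 dvd J {w} (P u\<^sub>1)" "[:0, 1:] ^ 2 dvd J {w} (P u\<^sub>2)"
      using J' atoms distinct by (auto intro!: monom_sq_dvd)
    then have "([:0, 1:] ^ 2) ^ a * ([:0, 1:] ^ 2) ^ b dvd J {w} (P w) ^ n"
      unfolding J_eq by (intro mult_dvd_mono dvd_power_same)
    then have "[:0, 1:] ^ (2 * (a + b)) dvd [:0, 1:] ^ n * r ^ n"
      unfolding r power_mult_distrib by (simp only: power_mult power_add)
    then show ?thesis
      by (rule monom_power_dvd_imp_le) (use r in \<open>simp add: poly_power\<close>)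
  qed
  \<comment> \<open>Now the roles are exchanged: the right side has order exactly
    \<open>a + b\<close>, the left side order at least \<open>2 * n\<close>.\<close>
  moreover have "2 * n \<le> a + b"
  proof -
    let ?U = "{u\<^sub>1, u\<^sub>2}"
    have J': "coeff (J ?U (P m)) 0 = 0" "coeff (J ?U (P m)) 1 = (if m \<in> ?U then 1 else 0)" if "atom v m" for m
      using J[of ?U m] atoms that by auto
    obtain r where r: "J ?U (P u\<^sub>1) = [:0, 1:] * r" "poly r 0 \<noteq> 0"
      using monom_mult_of_coeff_0[of "J ?U (P u\<^sub>1)"] J'[OF atoms(1)] by auto
    obtain q where q: "J ?U (P u\<^sub>2) = [:0, 1:] * q" "poly q 0 \<noteq> 0"
      using monom_mult_of_coeff_0[of "J ?U (P u\<^sub>2)"] J'[OF atoms(2)] by auto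
    have "[:0, 1:] ^ 2 dvd J ?U (P w)"
      using J' atoms distinct by (auto intro!: monom_sq_dvd)
    then have "([:0, 1:] ^ 2) ^ n dvd J ?U (P u\<^sub>1) ^ a * J ?U (P u\<^sub>2) ^ b"
      unfolding J_eq[symmetric] by (intro dvd_power_same)
    also have "\<dots> = [:0, 1:] ^ (a + b) * (r ^ a * q ^ b)"
      unfolding r q power_mult_distrib power_add by (simp only: mult_ac)
    finally have "[:0, 1:] ^ (2 * n) dvd [:0, 1:] ^ (a + b) * (r ^ a * q ^ b)"
      by (simp only: power_mult)
    then show ?thesis
      by (rule monom_power_dvd_imp_le) (use r q in \<open>simp add: poly_power\<close>)
  qed
  \<comment> \<open>Together \<open>4 * n \<le> 2 * (a + b) \<le> n\<close>.\<close>
  ultimately show ?thesis by simp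
qed

section \<open>Monoids generated by two exponents\<close>

definition lin_comb :: "('v \<Rightarrow>\<^sub>0 nat) \<Rightarrow> ('v \<Rightarrow>\<^sub>0 nat) \<Rightarrow> nat \<Rightarrow> nat \<Rightarrow> ('v \<Rightarrow>\<^sub>0 nat)"
  where "lin_comb u w i j = (\<Sum>k<i. u) + (\<Sum>k<j. w)"

lemma lookup_lin_comb:
  "Poly_Mapping.lookup (lin_comb u w i j) x = i * Poly_Mapping.lookup u x + j * Poly_Mapping.lookup w x"
  by (simp add: lin_comb_def lookup_add lookup_sum)

lemma lin_comb_simps: "lin_comb u w 0 0 = 0" "lin_comb u w 1 0 = u" "lin_comb u w 0 1 = w"
  by (simp_all add: lin_comb_def)

lemma lin_comb_add: "lin_comb u w i j + lin_comb u w i' j' = lin_comb u w (i + i') (j + j')"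
  by (rule poly_mapping_eqI) (simp add: lookup_lin_comb lookup_add algebra_simps)

lemma single_power: "Poly_Mapping.single m (c::complex) ^ n = Poly_Mapping.single (\<Sum>k<n. m) (c ^ n)"
  for m :: "'v \<Rightarrow>\<^sub>0 nat"
  by (induction n) (simp_all add: mult_single add.commute)

lemma single_lin_comb:
  "Poly_Mapping.single (lin_comb u w i j) (1::complex) = Poly_Mapping.single u 1 ^ i * Poly_Mapping.single w 1 ^ j"
  by (simp add: single_power mult_single lin_comb_def)

text \<open>Descent on the total degree: an exponent outside the submonoid \<open>T\<close> that is
  no atom splits into two smaller ones of weight 0, and they cannot both lie in
  \<open>T\<close>.\<close>

lemma exists_atom_notin:
  assumes T: "0 \<in> T" "\<And>a b. a \<in> T \<Longrightarrow> b \<in> T \<Longrightarrow> a + b \<in> T"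
    and "weight v m = 0" "m \<notin> T"
  shows "\<exists>w. atom v w \<and> w \<notin> T"
  using assms(3,4)
proof (induction "\<Sum>i\<in>UNIV. Poly_Mapping.lookup m i" arbitrary: m rule: less_induct)
  case less
  have size_pos: "0 < (\<Sum>i\<in>UNIV. Poly_Mapping.lookup a i)" if "a \<noteq> 0" for a :: "3 \<Rightarrow>\<^sub>0 nat"
    using that by (auto simp: poly_mapping_eq_iff fun_eq_iff intro!: sum_pos2)
  show ?case
  proof (cases "atom v m")
    case False
    have "m \<noteq> 0" using less.prems T(1) by auto
    then obtain a b where ab: "weight v a = 0" "weight v b = 0" "m = a + b" "a \<noteq> 0" "b \<noteq> 0"
      using False less.prems unfolding atom_def by blast
    have "(\<Sum>i\<in>UNIV. Poly_Mapping.lookup a i) < (\<Sum>i\<in>UNIV. Poly_Mapping.lookup m i)"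
         "(\<Sum>i\<in>UNIV. Poly_Mapping.lookup b i) < (\<Sum>i\<in>UNIV. Poly_Mapping.lookup m i)"
      using size_pos[OF ab(4)] size_pos[OF ab(5)] by (simp_all add: ab(3) lookup_add sum.distrib)
    moreover have "a \<notin> T \<or> b \<notin> T"
      using T(2) less.prems ab(3) by blast
    ultimately show ?thesis
      using less.hyps ab(1,2) by blast
  qed (use less.prems in blast)
qed

text \<open>If the weight-zero monoid is free on \<open>u\<close> and \<open>w\<close>, its monoid
  algebra is a polynomial ring in the two corresponding monomials.\<close>

lemma invariants_free_of_two_generators:
  assumes gen: "\<And>m. weight v m = 0 \<longleftrightarrow> (\<exists>i j. m = lin_comb u w i j)"
    and inj: "\<And>i j i' j'. lin_comb u w i j = lin_comb u w i' j' \<Longrightarrow> i = i' \<and> j = j'"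
  shows "\<exists>S. alg_independent S \<and> invariants (diag v) = subalgebra_gen S"
proof -
  let ?U = "Poly_Mapping.single u (1::complex)" and ?W = "Poly_Mapping.single w (1::complex)"
  have "u \<noteq> w"
    using inj[of 1 0 0 1] unfolding lin_comb_simps by auto
  then have UW: "?U \<noteq> ?W"
    by (metis lookup_single_eq lookup_single_not_eq zero_neq_one)
  have uw: "weight v u = 0" "weight v w = 0"
    unfolding gen by (metis lin_comb_simps(2), metis lin_comb_simps(3))
  have "alg_independent {?U, ?W}"
    unfolding alg_independent_def
  proof (intro allI impI)
    fix P :: "3 mpol mpol"
    assume vars: "vars_mpol P \<subseteq> {?U, ?W}" and zero: "subst_mpol (\<lambda>s. s) P = 0"
    \<comment> \<open>\<open>\<phi>\<close> gives the exponent into which substitution turns a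
      formal monomial. Its injectivity on the keys of \<open>P\<close> excludes
      cancellation.\<close>
    define \<phi> where "\<phi> = (\<lambda>m. lin_comb u w (Poly_Mapping.lookup m ?U) (Poly_Mapping.lookup m ?W))"
    have keys: "Poly_Mapping.keys m \<subseteq> {?U, ?W}" if "m \<in> Poly_Mapping.keys P" for m
      using vars that by (auto simp: vars_mpol_def)
    have "Const c * eval_monom (\<lambda>s. s) m = Poly_Mapping.single (\<phi> m) c" if "m \<in> Poly_Mapping.keys P" for m c
    proof -
      have "eval_monom (\<lambda>s. s) m = ?U ^ Poly_Mapping.lookup m ?U * ?W ^ Poly_Mapping.lookup m ?W"
        using UW by (subst eval_monom_superset[OF _ keys[OF that]]) simp_all
      then show ?thesis
        by (simp add: \<phi>_def flip: single_lin_comb) (simp add: Const_mult_single)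
    qed
    then have "subst_mpol (\<lambda>s. s) P = (\<Sum>m\<in>Poly_Mapping.keys P. Poly_Mapping.single (\<phi> m) (Poly_Mapping.lookup P m))"
      unfolding subst.eval_def by (intro sum.cong) simp_all
    with zero have sum0: "(\<Sum>m\<in>Poly_Mapping.keys P. Poly_Mapping.single (\<phi> m) (Poly_Mapping.lookup P m)) = 0"
      by simp
    have inj_phi: "inj_on \<phi> (Poly_Mapping.keys P)"
    proof (rule inj_onI)
      fix m n assume mn: "m \<in> Poly_Mapping.keys P" "n \<in> Poly_Mapping.keys P" "\<phi> m = \<phi> n"
      then have UW_eq: "Poly_Mapping.lookup m ?U = Poly_Mapping.lookup n ?U \<and> Poly_Mapping.lookup m ?W = Poly_Mapping.lookup n ?W"
        unfolding \<phi>_def by (intro inj)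
      show "m = n"
      proof (rule poly_mapping_eqI)
        fix s
        show "Poly_Mapping.lookup m s = Poly_Mapping.lookup n s"
        proof (cases "s \<in> {?U, ?W}")
          case False
          then have "s \<notin> Poly_Mapping.keys m" "s \<notin> Poly_Mapping.keys n"
            using keys[OF mn(1)] keys[OF mn(2)] by blast+
          then show ?thesis by (simp add: in_keys_iff)
        qed (use UW_eq in auto)
      qed
    qed
    show "P = 0"
    proof (rule ccontr)
      assume "P \<noteq> 0"
      then have "Poly_Mapping.keys P \<noteq> {}"
        using poly_mapping_sum_single[of P] by auto
      then obtain m where m: "m \<in> Poly_Mapping.keys P"
        by blast
      \<comment> \<open>At the exponent \<open>\<phi> m\<close> only the term of \<open>m\<close>
        itself contributes.\<close>
      have "0 = (\<Sum>n\<in>Poly_Mapping.keys P. Poly_Mapping.lookup (Poly_Mapping.single (\<phi> n) (Poly_Mapping.lookup P n)) (\<phi> m))"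
        using arg_cong[OF sum0, of "\<lambda>p. Poly_Mapping.lookup p (\<phi> m)"] by (simp add: lookup_sum)
      also have "\<dots> = (\<Sum>n\<in>Poly_Mapping.keys P. if n = m then Poly_Mapping.lookup P n else 0)"
        by (rule sum.cong) (use inj_phi m in \<open>auto simp: lookup_single when_def dest: inj_onD\<close>)
      also have "\<dots> = Poly_Mapping.lookup P m"
        using m by simp
      finally show False using m by (simp add: in_keys_iff)
    qed
  qed
  moreover have "invariants (diag v) = subalgebra_gen {?U, ?W}"
  proof
    show "invariants (diag v) \<subseteq> subalgebra_gen {?U, ?W}"
    proof
      fix p assume p: "p \<in> invariants (diag v)"
      have "(\<Sum>m\<in>Poly_Mapping.keys p. Poly_Mapping.single m (Poly_Mapping.lookup p m)) \<in> subalgebra_gen {?U, ?W}"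
      proof (rule subalgebra_gen_sum)
        fix m assume "m \<in> Poly_Mapping.keys p"
        then obtain i j where m: "m = lin_comb u w i j"
          using p gen by (auto simp: invariants_diag)
        have "Poly_Mapping.single m (Poly_Mapping.lookup p m) = Const (Poly_Mapping.lookup p m) * (?U ^ i * ?W ^ j)"
          unfolding single_lin_comb[symmetric] m by (simp add: Const_mult_single)
        then show "Poly_Mapping.single m (Poly_Mapping.lookup p m) \<in> subalgebra_gen {?U, ?W}"
          by (simp add: subalgebra_gen.intros subalgebra_gen_power)
      qed
      then show "p \<in> subalgebra_gen {?U, ?W}"
        by (simp add: poly_mapping_sum_single)
    qed
    show "subalgebra_gen {?U, ?W} \<subseteq> invariants (diag v)"
    proof
      fix p assume "p \<in> subalgebra_gen {?U, ?W}"
      then show "p \<in> invariants (diag v)"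
        by induction (use uw in \<open>auto simp: invariants_diag_add invariants_diag_mult invariants_diag[of "Poly_Mapping.single _ _"]\<close>)
    qed
  qed
  ultimately show ?thesis by blast
qed

section \<open>Exponent arithmetic\<close>

text \<open>Bezout over the naturals, scaled by the cofactor of \<open>a\<close>. The unknowns stand
  on opposite sides, so no negative solution arises.\<close>

lemma nat_linear_solvable:
  fixes a b c :: nat
  assumes "c > 0" "gcd c b dvd a"
  shows "\<exists>y z. a + b * y = c * z"
proof -
  obtain x y where xy: "c * x = b * y + gcd c b"
    using bezout_nat[of c b] assms(1) by auto
  obtain k where "a = gcd c b * k"
    using assms(2) by auto
  then have "a + b * (y * k) = (b * y + gcd c b) * k"
    by (simp add: algebra_simps)
  also have "\<dots> = c * (x * k)"
    by (simp flip: xy add: mult.assoc)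
  finally show ?thesis by blast
qed

text \<open>After division by the gcd the two coefficients are coprime, so that of \<open>y\<close>
  must divide \<open>x\<close>.\<close>

lemma div_gcd_dvd:
  fixes b c x y :: nat
  assumes "c > 0" "b * x = c * y"
  shows "c div gcd b c dvd x"
proof -
  have "c div gcd b c dvd b div gcd b c * x"
  proof
    have "b * x div gcd b c = c * y div gcd b c"
      using assms(2) by simp
    then show "b div gcd b c * x = c div gcd b c * y"
      by (simp add: div_mult_swap dvd_div_mult)
  qed
  moreover have "coprime (c div gcd b c) (b div gcd b c)"
    using assms(1) by (metis coprime_commute div_gcd_coprime not_gr_zero)
  ultimately show ?thesis
    by (simp add: coprime_dvd_mult_right_iff)
qed

definition exponent :: "nat \<Rightarrow> nat \<Rightarrow> nat \<Rightarrow> (3 \<Rightarrow>\<^sub>0 nat)"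
  where "exponent a b c = Abs_poly_mapping (\<lambda>i. vector [a, b, c] $ i)"

lemma lookup_exponent [simp]:
  "Poly_Mapping.lookup (exponent a b c) 1 = a"
  "Poly_Mapping.lookup (exponent a b c) 2 = b"
  "Poly_Mapping.lookup (exponent a b c) 3 = c"
  by (simp_all add: exponent_def vector_3)

lemma exponent_eq_iff:
  "m = n \<longleftrightarrow> Poly_Mapping.lookup m 1 = Poly_Mapping.lookup n 1 \<and>
    Poly_Mapping.lookup m 2 = Poly_Mapping.lookup n 2 \<and> Poly_Mapping.lookup m 3 = Poly_Mapping.lookup n 3"
  for m n :: "3 \<Rightarrow>\<^sub>0 nat"
  by (simp add: poly_mapping_eq_iff fun_eq_iff forall_3)

section \<open>The weights d1, d2, -d3 and their linear equations\<close>

context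
  fixes d1 d2 d3 :: nat and v :: "complex ^ 3"
  assumes pos: "d1 > 0" "d2 > 0" "d3 > 0" and gcd: "gcd d1 (gcd d2 d3) = 1"
    and v: "v = vector [of_nat d1, of_nat d2, - of_nat d3]"
begin

text \<open>Moving negative terms across turns a complex equation into one over the naturals. The
  pair \<open>a\<close>, \<open>b\<close> covers all targets in use: 0, \<open>d1\<close>,
  \<open>d2\<close> and \<open>- d3\<close>.\<close>

lemma weight_eq_of_nat_iff:
  "weight v m = of_nat a - of_nat b \<longleftrightarrow>
    d1 * Poly_Mapping.lookup m 1 + d2 * Poly_Mapping.lookup m 2 + b = a + d3 * Poly_Mapping.lookup m 3"
proof -
  have "weight v m = of_nat a - of_nat b \<longleftrightarrow>
    of_nat (d1 * Poly_Mapping.lookup m 1 + d2 * Poly_Mapping.lookup m 2 + b)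
      = (of_nat (a + d3 * Poly_Mapping.lookup m 3) :: complex)"
    by (auto simp: weight_def sum_3 v algebra_simps)
  then show ?thesis by (simp only: of_nat_eq_iff)
qed

lemma weight_eq_0_iff:
  "weight v m = 0 \<longleftrightarrow>
    d1 * Poly_Mapping.lookup m 1 + d2 * Poly_Mapping.lookup m 2 = d3 * Poly_Mapping.lookup m 3"
  using weight_eq_of_nat_iff[of m 0 0] by simp

text \<open>An offending exponent in component 1 solves \<open>d2 * y = d1 + d3 * z\<close>, which
  is possible iff \<open>gcd d2 d3\<close> divides \<open>d1\<close>; as the three numbers have gcd
  1, this means \<open>gcd d2 d3 = 1\<close>. Component 2 is symmetric, and component 3 never fails
  by positivity.\<close>

lemma centralizer_condition_iff:
  "(\<forall>i m. weight v m = v $ i \<longrightarrow> Poly_Mapping.lookup m i \<noteq> 0) \<longleftrightarrow> gcd d2 d3 \<noteq> 1 \<and> gcd d1 d3 \<noteq> 1"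
proof -
  have w1: "weight v m = v $ 1 \<longleftrightarrow>
      d1 * Poly_Mapping.lookup m 1 + d2 * Poly_Mapping.lookup m 2 = d1 + d3 * Poly_Mapping.lookup m 3" for m
    using weight_eq_of_nat_iff[of m d1 0] by (simp add: v)
  have w2: "weight v m = v $ 2 \<longleftrightarrow>
      d1 * Poly_Mapping.lookup m 1 + d2 * Poly_Mapping.lookup m 2 = d2 + d3 * Poly_Mapping.lookup m 3" for m
    using weight_eq_of_nat_iff[of m d2 0] by (simp add: v)
  have w3: "weight v m = v $ 3 \<longleftrightarrow>
      d1 * Poly_Mapping.lookup m 1 + d2 * Poly_Mapping.lookup m 2 + d3 = d3 * Poly_Mapping.lookup m 3" for m
    using weight_eq_of_nat_iff[of m 0 d3] by (simp add: v)
  have "(\<forall>m. weight v m = v $ 1 \<longrightarrow> Poly_Mapping.lookup m 1 \<noteq> 0) \<longleftrightarrow> gcd d2 d3 \<noteq> 1"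
  proof
    assume *: "\<forall>m. weight v m = v $ 1 \<longrightarrow> Poly_Mapping.lookup m 1 \<noteq> 0"
    show "gcd d2 d3 \<noteq> 1"
    proof
      assume "gcd d2 d3 = 1"
      then obtain z y where "d1 + d3 * z = d2 * y"
        using nat_linear_solvable[of d2 d3 d1] pos by (metis one_dvd)
      then show False
        \<comment> \<open>This monomial has the weight of component 1 but omits the first
          variable.\<close>
        using *[rule_format, of "exponent 0 y z"] by (simp add: w1)
    qed
  next
    assume ne: "gcd d2 d3 \<noteq> 1"
    show "\<forall>m. weight v m = v $ 1 \<longrightarrow> Poly_Mapping.lookup m 1 \<noteq> 0"
    proof (intro allI impI notI)
      fix m assume "weight v m = v $ 1" "Poly_Mapping.lookup m 1 = 0"
      then have eq: "d2 * Poly_Mapping.lookup m 2 = d1 + d3 * Poly_Mapping.lookup m 3"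
        by (simp add: w1)
      have "gcd d2 d3 dvd d1 + d3 * Poly_Mapping.lookup m 3"
        unfolding eq[symmetric] by simp
      then have "gcd d2 d3 dvd d1"
        by (simp add: dvd_add_left_iff)
      then have "gcd d2 d3 dvd gcd d1 (gcd d2 d3)" by simp
      then show False
        using ne gcd by simp
    qed
  qed
  moreover have "(\<forall>m. weight v m = v $ 2 \<longrightarrow> Poly_Mapping.lookup m 2 \<noteq> 0) \<longleftrightarrow> gcd d1 d3 \<noteq> 1"
  proof
    assume *: "\<forall>m. weight v m = v $ 2 \<longrightarrow> Poly_Mapping.lookup m 2 \<noteq> 0"
    show "gcd d1 d3 \<noteq> 1"
    proof
      assume "gcd d1 d3 = 1"
      then obtain z y where "d2 + d3 * z = d1 * y"
        using nat_linear_solvable[of d1 d3 d2] pos by (metis one_dvd)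
      then show False
        using *[rule_format, of "exponent y 0 z"] by (simp add: w2)
    qed
  next
    assume ne: "gcd d1 d3 \<noteq> 1"
    show "\<forall>m. weight v m = v $ 2 \<longrightarrow> Poly_Mapping.lookup m 2 \<noteq> 0"
    proof (intro allI impI notI)
      fix m assume "weight v m = v $ 2" "Poly_Mapping.lookup m 2 = 0"
      then have eq: "d1 * Poly_Mapping.lookup m 1 = d2 + d3 * Poly_Mapping.lookup m 3"
        by (simp add: w2)
      have "gcd d1 d3 dvd d2 + d3 * Poly_Mapping.lookup m 3"
        unfolding eq[symmetric] by simp
      then have "gcd d1 d3 dvd d2"
        by (simp add: dvd_add_left_iff)
      then have "gcd d1 d3 dvd gcd d1 (gcd d2 d3)" by simp
      then show False
        using ne gcd by simp
    qed
  qed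
  moreover have "\<forall>m. weight v m = v $ 3 \<longrightarrow> Poly_Mapping.lookup m 3 \<noteq> 0"
  proof (intro allI impI notI)
    fix m assume "weight v m = v $ 3" "Poly_Mapping.lookup m 3 = 0"
    then show False using pos by (simp add: w3)
  qed
  ultimately show ?thesis
    by (simp add: forall_3)
qed

text \<open>Divisibility forces the first two exponents of a weight-zero monomial to be multiples of
  \<open>l1\<close> and \<open>l2\<close>, and the multipliers determine the third. So the monoid is
  free on \<open>u\<close> and \<open>w\<close>.\<close>

lemma invariants_free:
  assumes "coprime l1 l2" "l2 dvd d1" "l1 dvd d2" "d3 = l1 * l2"
  shows "\<exists>S. alg_independent S \<and> invariants (diag v) = subalgebra_gen S"
proof -
  obtain e1 e2 where e: "d1 = l2 * e1" "d2 = l1 * e2"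
    using assms(2,3) by (auto elim!: dvdE)
  have l: "l1 > 0" "l2 > 0" using pos assms(4) by auto
  \<comment> \<open>A common divisor would also divide \<open>d2\<close> and \<open>d3\<close>
    through \<open>l1\<close>.\<close>
  have cop1: "coprime l1 d1"
  proof (rule coprimeI)
    fix c assume "c dvd l1" "c dvd d1"
    then have "c dvd gcd d1 (gcd d2 d3)"
      using assms(3,4) by (meson dvd_trans dvd_triv_left gcd_greatest)
    then show "is_unit c" using gcd by simp
  qed
  have cop2: "coprime l2 d2"
  proof (rule coprimeI)
    fix c assume "c dvd l2" "c dvd d2"
    then have "c dvd gcd d1 (gcd d2 d3)"
      using assms(2,4) by (meson dvd_trans dvd_triv_right gcd_greatest)
    then show "is_unit c" using gcd by simp
  qed
  define u where "u = exponent l1 0 e1"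
  define w where "w = exponent 0 l2 e2"
  show ?thesis
  proof (rule invariants_free_of_two_generators)
    fix m
    show "weight v m = 0 \<longleftrightarrow> (\<exists>i j. m = lin_comb u w i j)"
    proof
      assume "weight v m = 0"
      then have eq: "d1 * Poly_Mapping.lookup m 1 + d2 * Poly_Mapping.lookup m 2 = d3 * Poly_Mapping.lookup m 3"
        by (simp add: weight_eq_0_iff)
      \<comment> \<open>The sum is a multiple of \<open>d3 = l1 * l2\<close>; \<open>l1\<close>
        already divides the second summand and \<open>l2\<close> the first.\<close>
      have "l1 dvd d1 * Poly_Mapping.lookup m 1 + d2 * Poly_Mapping.lookup m 2"
        "l2 dvd d1 * Poly_Mapping.lookup m 1 + d2 * Poly_Mapping.lookup m 2"
        unfolding eq assms(4) by simp_all
      then have "l1 dvd d1 * Poly_Mapping.lookup m 1" "l2 dvd d2 * Poly_Mapping.lookup m 2"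
        using assms(2,3) by (simp_all add: dvd_add_left_iff dvd_add_right_iff)
      then have "l1 dvd Poly_Mapping.lookup m 1" "l2 dvd Poly_Mapping.lookup m 2"
        using cop1 cop2 by (simp_all add: coprime_dvd_mult_right_iff)
      then obtain i j where ij: "Poly_Mapping.lookup m 1 = l1 * i" "Poly_Mapping.lookup m 2 = l2 * j"
        by (auto elim!: dvdE)
      have "(l1 * l2) * (e1 * i + e2 * j) = (l1 * l2) * Poly_Mapping.lookup m 3"
        using eq by (simp add: ij e assms(4) algebra_simps)
      then have "e1 * i + e2 * j = Poly_Mapping.lookup m 3"
        using l by simp
      then have "m = lin_comb u w i j"
        by (simp add: exponent_eq_iff[of m] lookup_lin_comb u_def w_def ij mult.commute)
      then show "\<exists>i j. m = lin_comb u w i j" by blast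
    next
      assume "\<exists>i j. m = lin_comb u w i j"
      then show "weight v m = 0"
        by (auto simp: weight_eq_0_iff lookup_lin_comb u_def w_def e assms(4) algebra_simps)
    qed
  next
    fix i j i' j' assume eq: "lin_comb u w i j = lin_comb u w i' j'"
    show "i = i' \<and> j = j'"
      using arg_cong[OF eq, of "\<lambda>m. Poly_Mapping.lookup m 1"] arg_cong[OF eq, of "\<lambda>m. Poly_Mapping.lookup m 2"] l
      by (simp add: lookup_lin_comb u_def w_def)
  qed
qed

lemma d3_div_gcd_neq_0: "d3 div gcd b d3 \<noteq> 0"
  using pos by (simp add: dvd_div_eq_0_iff)

text \<open>A summand omits the second variable, so its first exponent is a multiple of
  \<open>d3 div gcd d1 d3\<close>. One of the two summands therefore has first exponent 0, and then
  its third vanishes as well.\<close>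

lemma atom_exponent_13: "atom v (exponent (d3 div gcd d1 d3) 0 (d1 div gcd d1 d3))" (is "atom v ?u")
  unfolding atom_def
proof (intro conjI allI impI)
  show "weight v ?u = 0"
    by (simp add: weight_eq_0_iff div_mult_swap mult.commute)
  have "Poly_Mapping.lookup ?u 1 \<noteq> 0" using d3_div_gcd_neq_0 by (simp only: lookup_exponent) simp
  then show "?u \<noteq> 0" by (metis lookup_zero)
  fix a b assume ab: "weight v a = 0" "weight v b = 0" "a + b = ?u"
  have sum: "Poly_Mapping.lookup a i + Poly_Mapping.lookup b i = Poly_Mapping.lookup ?u i" for i
    by (simp flip: ab(3) add: lookup_add)
  have two: "Poly_Mapping.lookup a 2 = 0" "Poly_Mapping.lookup b 2 = 0"
    using sum[of 2] by simp_all
  have zero: "c = 0" if "weight v c = 0" "Poly_Mapping.lookup c 1 = 0" "Poly_Mapping.lookup c 2 = 0" for c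
    using that pos by (simp add: weight_eq_0_iff exponent_eq_iff[of c])
  have "d3 div gcd d1 d3 dvd Poly_Mapping.lookup a 1"
    using ab(1) two pos by (intro div_gcd_dvd[of _ _ _ "Poly_Mapping.lookup a 3"]) (simp_all add: weight_eq_0_iff)
  then have "Poly_Mapping.lookup a 1 = 0 \<or> d3 div gcd d1 d3 \<le> Poly_Mapping.lookup a 1"
    using dvd_imp_le by blast
  then have "Poly_Mapping.lookup a 1 = 0 \<or> Poly_Mapping.lookup b 1 = 0"
    using sum[of 1] unfolding lookup_exponent by linarith
  then show "a = 0 \<or> b = 0"
    using zero ab(1,2) two by blast
qed

text \<open>The same argument with the first two variables exchanged.\<close>

lemma atom_exponent_23: "atom v (exponent 0 (d3 div gcd d2 d3) (d2 div gcd d2 d3))" (is "atom v ?u")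
  unfolding atom_def
proof (intro conjI allI impI)
  show "weight v ?u = 0"
    by (simp add: weight_eq_0_iff div_mult_swap mult.commute)
  have "Poly_Mapping.lookup ?u 2 \<noteq> 0" using d3_div_gcd_neq_0 by (simp only: lookup_exponent) simp
  then show "?u \<noteq> 0" by (metis lookup_zero)
  fix a b assume ab: "weight v a = 0" "weight v b = 0" "a + b = ?u"
  have sum: "Poly_Mapping.lookup a i + Poly_Mapping.lookup b i = Poly_Mapping.lookup ?u i" for i
    by (simp flip: ab(3) add: lookup_add)
  have one: "Poly_Mapping.lookup a 1 = 0" "Poly_Mapping.lookup b 1 = 0"
    using sum[of 1] by simp_all
  have zero: "c = 0" if "weight v c = 0" "Poly_Mapping.lookup c 1 = 0" "Poly_Mapping.lookup c 2 = 0" for c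
    using that pos by (simp add: weight_eq_0_iff exponent_eq_iff[of c])
  have "d3 div gcd d2 d3 dvd Poly_Mapping.lookup a 2"
    using ab(1) one pos by (intro div_gcd_dvd[of _ _ _ "Poly_Mapping.lookup a 3"]) (simp_all add: weight_eq_0_iff)
  then have "Poly_Mapping.lookup a 2 = 0 \<or> d3 div gcd d2 d3 \<le> Poly_Mapping.lookup a 2"
    using dvd_imp_le by blast
  then have "Poly_Mapping.lookup a 2 = 0 \<or> Poly_Mapping.lookup b 2 = 0"
    using sum[of 2] unfolding lookup_exponent by linarith
  then show "a = 0 \<or> b = 0"
    using zero ab(1,2) one by blast
qed

lemma coprime_gcds: "coprime (gcd d2 d3) (gcd d1 d3)"
proof (rule coprimeI)
  fix c assume "c dvd gcd d2 d3" "c dvd gcd d1 d3"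
  then have "c dvd gcd d1 (gcd d2 d3)" by simp
  then show "is_unit c" using gcd by simp
qed

text \<open>A third atom is excluded by \<open>atoms_contradict_free\<close>, so \<open>u\<close>
  and \<open>w\<close> generate the whole monoid. A suitable element of the monoid then shows that
  \<open>d3\<close> divides the product of the gcds.\<close>

lemma d3_eq_of_invariants_free:
  assumes S: "alg_independent S" "invariants (diag v) = subalgebra_gen S"
  shows "d3 = gcd d2 d3 * gcd d1 d3"
proof -
  let ?g1 = "gcd d2 d3" and ?g2 = "gcd d1 d3"
  define u where "u = exponent (d3 div ?g2) 0 (d1 div ?g2)"
  define w where "w = exponent 0 (d3 div ?g1) (d2 div ?g1)"
  define T where "T = {lin_comb u w i j | i j. True}"
  have T_I: "lin_comb u w i j \<in> T" for i j
    unfolding T_def by blast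
  have in_T: "m \<in> T" if "weight v m = 0" for m
  proof (rule ccontr)
    assume "m \<notin> T"
    moreover have "0 \<in> T"
      using T_I[of 0 0] by (simp only: lin_comb_simps)
    moreover have "a + b \<in> T" if ab: "a \<in> T" "b \<in> T" for a b
    proof -
      obtain i j i' j' where "a = lin_comb u w i j" "b = lin_comb u w i' j'"
        using ab unfolding T_def by blast
      then show ?thesis by (simp only: lin_comb_add T_I)
    qed
    ultimately obtain x where x: "atom v x" "x \<notin> T"
      using exists_atom_notin[of T v m] \<open>weight v m = 0\<close> by blast
    have "u \<in> T" "w \<in> T"
      using T_I[of 1 0] T_I[of 0 1] by (simp_all only: lin_comb_simps)
    with x(2) have "x \<noteq> u" "x \<noteq> w" by auto
    moreover have "u \<noteq> w"
    proof
      assume "u = w"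
      then have "Poly_Mapping.lookup u 1 = Poly_Mapping.lookup w 1" by simp
      then show False
        using d3_div_gcd_neq_0 by (simp only: u_def w_def lookup_exponent)
    qed
    \<comment> \<open>The multipliers are forced by the first two coordinates; the third agrees
      because \<open>x\<close> has weight 0.\<close>
    moreover have "lin_comb x 0 d3 0 = lin_comb u w (?g2 * Poly_Mapping.lookup x 1) (?g1 * Poly_Mapping.lookup x 2)"
    proof -
      have third: "d3 * Poly_Mapping.lookup x 3 =
          ?g2 * (d1 div ?g2) * Poly_Mapping.lookup x 1 + ?g1 * (d2 div ?g1) * Poly_Mapping.lookup x 2"
        using x(1) by (simp add: atom_def weight_eq_0_iff)
      have "d3 * Poly_Mapping.lookup x 1 = ?g2 * (d3 div ?g2) * Poly_Mapping.lookup x 1"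
        "d3 * Poly_Mapping.lookup x 2 = ?g1 * (d3 div ?g1) * Poly_Mapping.lookup x 2"
        by simp_all
      with third show ?thesis
        unfolding exponent_eq_iff lookup_lin_comb u_def w_def lookup_exponent by (simp only: mult_ac) simp
    qed
    then have "Poly_Mapping.single x (1::complex) ^ d3 = Poly_Mapping.single u 1 ^ (?g2 * Poly_Mapping.lookup x 1)
        * Poly_Mapping.single w 1 ^ (?g1 * Poly_Mapping.lookup x 2)"
      unfolding single_lin_comb[symmetric] by (simp add: single_power lin_comb_def)
    ultimately have "d3 = 0"
      using atoms_contradict_free[OF S atom_exponent_13 atom_exponent_23 x(1)] by (simp add: u_def w_def)
    then show False using pos by simp
  qed
  \<comment> \<open>This solvability condition yields an element of the monoid with first exponent
    \<open>?g1\<close>. Generation by \<open>u\<close> and \<open>w\<close> makes that exponent a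
    multiple of \<open>d3 div ?g2\<close>.\<close>
  have "?g1 dvd d1 * ?g1" by simp
  then obtain y z where yz: "d1 * ?g1 + d2 * y = d3 * z"
    using nat_linear_solvable[of d3 d2 "d1 * ?g1"] pos by (auto simp: gcd.commute)
  then have "exponent ?g1 y z \<in> T"
    by (intro in_T) (simp add: weight_eq_0_iff)
  then obtain i j where "exponent ?g1 y z = lin_comb u w i j"
    by (auto simp: T_def)
  then have "Poly_Mapping.lookup (exponent ?g1 y z) 1 = Poly_Mapping.lookup (lin_comb u w i j) 1"
    by simp
  then have "?g1 = i * (d3 div ?g2)"
    by (simp add: lookup_lin_comb u_def w_def)
  then have "?g1 * ?g2 = i * (d3 div ?g2 * ?g2)"
    by (simp only: mult.assoc)
  then have "?g1 * ?g2 = i * d3"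
    by (simp only: dvd_div_mult_self gcd_dvd2)
  then have "d3 dvd ?g1 * ?g2" by simp
  moreover have "?g1 * ?g2 dvd d3"
    by (rule divides_mult) (simp_all add: coprime_gcds)
  ultimately show ?thesis by (rule dvd_antisym)
qed

end

theorem proposition13:
  fixes d1 d2 d3 :: nat and B :: "complex ^ 3 ^ 3"
  assumes "d1 > 0" and "d2 > 0" and "d3 > 0"
    and "gcd d1 (gcd d2 d3) = 1"
    and "B = diag (vector [of_nat d1, of_nat d2, - of_nat d3])"
  shows "(pol_centralizer B = module_span (invariants B) {Q 1, Q 2, Q 3} \<and>
          (\<exists>S. alg_independent S \<and> invariants B = subalgebra_gen S))
     \<longleftrightarrow> (\<exists>l1 l2 :: nat. coprime l1 l2 \<and> l1 > 1 \<and> l2 > 1 \<and>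
            l2 dvd d1 \<and> l1 dvd d2 \<and> d3 = l1 * l2)"
    (is "?generated \<and> ?free \<longleftrightarrow> ?factors")
proof
  \<comment> \<open>Here \<open>refl\<close> takes \<open>v\<close> to be the vector from which
    \<open>B\<close> is built.\<close>
  note d = assms(1-4) refl
  have generated: "?generated \<longleftrightarrow> gcd d2 d3 \<noteq> 1 \<and> gcd d1 d3 \<noteq> 1"
    unfolding assms(5) pol_centralizer_diag_eq_span_iff by (rule centralizer_condition_iff[OF d])
  show ?factors if a: "?generated \<and> ?free"
  \<comment> \<open>The witnesses are \<open>l1 = gcd d2 d3\<close> and
    \<open>l2 = gcd d1 d3\<close>, fixed by the first \<open>show\<close>.\<close>
  proof (intro exI conjI)
    show "coprime (gcd d2 d3) (gcd d1 d3)"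
      by (rule coprime_gcds[OF d])
    have "gcd d2 d3 \<noteq> 1" "gcd d1 d3 \<noteq> 1" "gcd d2 d3 > 0" "gcd d1 d3 > 0"
      using conjunct1[OF a] unfolding generated using assms(3) by simp_all
    then show "gcd d2 d3 > 1" "gcd d1 d3 > 1" by linarith+
    obtain S where "alg_independent S" "invariants B = subalgebra_gen S"
      using conjunct2[OF a] by blast
    then show "d3 = gcd d2 d3 * gcd d1 d3"
      unfolding assms(5) by (rule d3_eq_of_invariants_free[OF d])
  qed simp_all
  show "?generated \<and> ?free" if factors: ?factors
  proof -
    obtain l1 l2 where l: "coprime l1 l2" "l1 > 1" "l2 > 1" "l2 dvd d1" "l1 dvd d2" "d3 = l1 * l2"
      using factors by blast
    \<comment> \<open>The gcds have divisors greater than 1, so neither equals 1.\<close>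
    have "l1 dvd gcd d2 d3" "l2 dvd gcd d1 d3"
      using l by auto
    then have "?generated"
      unfolding generated by (metis l(2,3) less_irrefl nat_dvd_1_iff_1)
    moreover have ?free
      unfolding assms(5) by (rule invariants_free[OF d l(1,4-6)])
    ultimately show ?thesis ..
  qed
qed

end
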